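(* Let $0<q<p\le1$, $k\in\mathbb{Z}$ and $n\ge1$. Then $$E_{n,p,q}^{(k)}(x)+E_{n,p,q}^{(k)}(x+1)=2B_{n,p,q}^{(k)}(-x)-2B_{n,p,q}^{(k)}(1-x).$$
   Context: $[n]_{p,q}=\frac{p^n-q^n}{p-q}$; $\mathrm{Li}_{k,p,q}(t)=\sum_{n\ge1} t^n/[n]_{p,q}^k$. The $(p,q)$-poly-Euler polynomials are defined by $\frac{2\,\mathrm{Li}_{k,p,q}(1-e^{-t})}{1+e^{t}}e^{xt}=\sum_{n\ge0} E_{n,p,q}^{(k)}(x)\frac{t^n}{n!}$. The $(p,q)$-poly-Bernoulli polynomials are defined by $\frac{\mathrm{Li}_{k,p,q}(1-e^{-t})}{1-e^{-t}}e^{-xt}=\sum_{n\ge0}B_{n,p,q}^{(k)}(x)\frac{t^n}{n!}$. *)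

theory Defs
  imports Complex_Main "HOL-Computational_Algebra.Formal_Power_Series"
begin

definition pq_number :: "real \<Rightarrow> real \<Rightarrow> nat \<Rightarrow> real" where
  "pq_number p q n = (p ^ n - q ^ n) / (p - q)"

text \<open>Generating functions are formal power series in \<open>t\<close>. The coefficient field \<open>'a\<close> is an
  arbitrary field extension of the reals, so that the argument \<open>x\<close> of the polynomials below
  may be real or complex.\<close>

definition pq_polylog :: "int \<Rightarrow> real \<Rightarrow> real \<Rightarrow> 'a::real_field fps" where
  "pq_polylog k p q = Abs_fps (\<lambda>n. if n = 0 then 0 else of_real (1 / pq_number p q n powi k))"

definition pq_poly_Euler :: "int \<Rightarrow> real \<Rightarrow> real \<Rightarrow> nat \<Rightarrow> 'a::real_field \<Rightarrow> 'a" where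
  "pq_poly_Euler k p q n x =
     fact n * fps_nth
       (2 * fps_compose (pq_polylog k p q) (1 - fps_exp (-1)) / (1 + fps_exp 1) * fps_exp x) n"

text \<open>The division below is exact: numerator and denominator both have zero constant
  coefficient, and \<open>1 - fps_exp (-1)\<close> has subdegree 1.\<close>

definition pq_poly_Bernoulli :: "int \<Rightarrow> real \<Rightarrow> real \<Rightarrow> nat \<Rightarrow> 'a::real_field \<Rightarrow> 'a" where
  "pq_poly_Bernoulli k p q n x =
     fact n * fps_nth
       (fps_compose (pq_polylog k p q) (1 - fps_exp (-1)) / (1 - fps_exp (-1)) * fps_exp (- x)) n"

end

theory Submission imports Defs begin

text \<open>With \<open>L = Li(1 - exp (-t))\<close>, the factor \<open>1 + exp t\<close> arising from the left-hand side cancels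
  the Euler denominator, and the factor \<open>1 - exp (-t)\<close> arising from the right-hand side cancels
  the Bernoulli denominator: both sides have exponential generating function \<open>2 L exp (x t)\<close>.\<close>

text \<open>A series without constant term has a factor \<open>fps_X\<close>, which composition with
  \<open>g\<close> turns into a factor \<open>g\<close>. This makes division by a non-unit such as
  \<open>1 - fps_exp (-1)\<close> exact.\<close>

lemma dvd_fps_compose_if_nth_0:
  fixes f g :: "'a::field fps"
  assumes "fps_nth f 0 = 0" and "fps_nth g 0 = 0"
  shows "g dvd fps_compose f g"
proof -
  have "f = fps_X * fps_shift 1 f"
    using assms(1) by (simp add: fps_eq_iff)
  then have "fps_compose f g = fps_compose (fps_X * fps_shift 1 f) g"
    by (rule arg_cong)
  also have "\<dots> = g * fps_compose (fps_shift 1 f) g"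
    using assms(2) by (simp add: fps_compose_mult_distrib)
  finally show ?thesis
    by simp
qed

lemma pq_poly_Euler_add_shift:
  fixes x :: "'a::real_field"
  shows "pq_poly_Euler k p q n x + pq_poly_Euler k p q n (x + 1) =
         fact n * fps_nth
           (2 * fps_compose (pq_polylog k p q) (1 - fps_exp (-1)) * fps_exp x) n"
proof -
  define L :: "'a fps" where "L = 2 * fps_compose (pq_polylog k p q) (1 - fps_exp (-1))"
  define D :: "'a fps" where "D = 1 + fps_exp 1"
  define Q where "Q = L / D"
  \<comment> \<open>The constant coefficient of \<open>D\<close> is 2, which is nonzero in a field
    extension of the reals.\<close>
  have "is_unit D"
    by (simp add: D_def)
  then have "D dvd L"
    by (rule unit_imp_dvd)
  then have L: "Q * D = L"
    unfolding Q_def by (rule dvd_div_mult_self)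
  have "pq_poly_Euler k p q n x + pq_poly_Euler k p q n (x + 1) =
      fact n * fps_nth (Q * fps_exp x + Q * fps_exp (x + 1)) n"
    unfolding pq_poly_Euler_def L_def[symmetric] D_def[symmetric] Q_def[symmetric]
    by (simp only: distrib_left fps_add_nth)
  \<comment> \<open>Shifting \<open>x\<close> by 1 multiplies the generating function by
    \<open>fps_exp 1\<close>, so the sum collects the factor \<open>D\<close>.\<close>
  also have "Q * fps_exp x + Q * fps_exp (x + 1) = Q * D * fps_exp x"
    unfolding fps_exp_add_mult D_def by (simp only: ring_distribs mult_ac mult_1_left mult_1_right)
  finally show ?thesis
    unfolding L unfolding L_def .
qed

lemma pq_poly_Bernoulli_diff_shift:
  fixes x :: "'a::real_field"
  shows "pq_poly_Bernoulli k p q n (- x) - pq_poly_Bernoulli k p q n (1 - x) =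
         fact n * fps_nth
           (fps_compose (pq_polylog k p q) (1 - fps_exp (-1)) * fps_exp x) n"
proof -
  define D :: "'a fps" where "D = 1 - fps_exp (-1)"
  define L :: "'a fps" where "L = fps_compose (pq_polylog k p q) D"
  define Q where "Q = L / D"
  \<comment> \<open>Here \<open>D\<close> has zero constant coefficient and is no unit; divisibility
    comes from the polylogarithm starting at degree 1.\<close>
  have "D dvd L"
    unfolding L_def by (rule dvd_fps_compose_if_nth_0) (simp_all add: D_def pq_polylog_def)
  then have L: "Q * D = L"
    unfolding Q_def by (rule dvd_div_mult_self)
  \<comment> \<open>The sign in \<open>fps_exp (- x)\<close> turns the arguments \<open>- x\<close>
    and \<open>1 - x\<close> into the exponents \<open>x\<close> and \<open>x - 1\<close>. The form
    \<open>x + - 1\<close> lets the addition law split off the \<open>fps_exp (-1)\<close> that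
    occurs in \<open>D\<close>.\<close>
  have "pq_poly_Bernoulli k p q n (- x) - pq_poly_Bernoulli k p q n (1 - x) =
      fact n * fps_nth (Q * fps_exp x - Q * fps_exp (x + - 1)) n"
    unfolding pq_poly_Bernoulli_def D_def[symmetric] L_def[symmetric] Q_def[symmetric]
    by (simp add: right_diff_distrib)
  also have "Q * fps_exp x - Q * fps_exp (x + - 1) = Q * D * fps_exp x"
    unfolding fps_exp_add_mult D_def by (simp only: ring_distribs mult_ac mult_1_left mult_1_right)
  finally show ?thesis
    unfolding L unfolding L_def D_def .
qed

theorem theorem8:
  fixes p q :: real and k :: int and n :: nat and x :: "'a::real_field"
  assumes "0 < q" and "q < p" and "p \<le> 1" and "n \<ge> 1"
  shows "pq_poly_Euler k p q n x + pq_poly_Euler k p q n (x + 1) =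
         2 * pq_poly_Bernoulli k p q n (- x) - 2 * pq_poly_Bernoulli k p q n (1 - x)"
proof -
  define F :: "'a fps" where
    "F = fps_compose (pq_polylog k p q) (1 - fps_exp (-1)) * fps_exp x"
  have "pq_poly_Euler k p q n x + pq_poly_Euler k p q n (x + 1) = fact n * fps_nth (2 * F) n"
    unfolding pq_poly_Euler_add_shift F_def by (simp only: mult.assoc)
  \<comment> \<open>Reading \<open>2 * F\<close> as \<open>F + F\<close> reduces this to additivity
    of coefficients.\<close>
  also have "\<dots> = 2 * (fact n * fps_nth F n)"
    by (simp only: mult_2 fps_add_nth distrib_left)
  also have "fact n * fps_nth F n =
      pq_poly_Bernoulli k p q n (- x) - pq_poly_Bernoulli k p q n (1 - x)"
    unfolding pq_poly_Bernoulli_diff_shift F_def ..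
  finally show ?thesis
    by (simp only: right_diff_distrib)
qed

end
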